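(* Let $X$ be a Banach space and let $\mathcal{T}=\{T_t\}_{t\in\Delta}$ be a $C_0$-semigroup on $X$ indexed by a complex sector $\Delta$. If $\{T_t\}_{t\in\Delta}$ admits a distributionally semi-irregular vector, then $\{T_t\}_{t\in\Delta}$ is distributionally sensitive.
   Context: A complex sector is $\Delta=\Delta(\alpha)=\{re^{i\theta}\in\mathbb{C}: r\ge 0,\ |\theta|\le\alpha\}$ for some $\alpha\in(0,\pi/2)$; it is a semigroup under addition. For $r>0$ put $\Delta_r=\{t\in\Delta:|t|<r\}$. With $\mu$ the (planar) Lebesgue measure, the upper density of a measurable $A\subset\Delta$ is $\overline{\mathrm{dens}}(A)=\limsup_{r\to\infty}\mu(A\cap\Delta_r)/\mu(\Delta_r)$. A family $\{T_t\}_{t\in\Delta}$ of continuous linear operators on a Banach space $X$ is a $C_0$-semigroup if $T_0=I$, $T_tT_s=T_{t+s}$ for all $t,s\in\Delta$, and $\lim_{t\to s}T_tx=T_sx$ in norm for all $s\in\Delta$, $x\in X$. A vector $x\in X$ is distributionally semi-irregular if there are measurable $A,B\subset\Delta$ with $\overline{\mathrm{dens}}(A)=\overline{\mathrm{dens}}(B)=1$ such that $\lim_{t\in A,\,|t|\to\infty}\|T_tx\|=0$ and $\liminf_{t\in B,\,|t|\to\infty}\|T_tx\|>0$ (the value $+\infty$ is allowed). $\mathcal{T}$ is distributionally sensitive if there is $\delta>0$ such that for every $x\in X$ and $\varepsilon>0$ there is $y\in X$ with $\|x-y\|<\varepsilon$ and $\overline{\mathrm{dens}}(\{t\in\Delta:\|T_tx-T_ty\|>\delta\})=1$.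 *)

theory Defs
  imports "HOL-Analysis.Analysis"
begin

definition sector :: "real \<Rightarrow> complex set" where
  "sector \<alpha> = {rcis r \<theta> | r \<theta>. 0 \<le> r \<and> \<bar>\<theta>\<bar> \<le> \<alpha>}"

text \<open>
  The index set \<open>\<Delta>\<close> is a parameter of the notions below; the notions are intended for
  \<open>\<Delta> = sector \<alpha>\<close> with \<open>0 < \<alpha> < pi / 2\<close>.
\<close>

definition truncated :: "complex set \<Rightarrow> real \<Rightarrow> complex set" where
  "truncated \<Delta> r = {t \<in> \<Delta>. cmod t < r}"

text \<open>
  The density is \<^typ>\<open>ereal\<close>-valued because \<^const>\<open>Limsup\<close> needs a complete lattice.
  It is meaningful only for Lebesgue measurable \<open>A\<close>.
\<close>

definition upper_dens :: "complex set \<Rightarrow> complex set \<Rightarrow> ereal" where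
  "upper_dens \<Delta> A =
     Limsup at_top (\<lambda>r::real. ereal (measure lebesgue (A \<inter> truncated \<Delta> r)
                                    / measure lebesgue (truncated \<Delta> r)))"

text \<open>
  Operators are real-linear on a real Banach space. This includes complex Banach spaces
  and complex-linear operators by restriction of scalars: none of the notions below
  refers to the scalar field.
\<close>

definition C0_semigroup ::
    "complex set \<Rightarrow> (complex \<Rightarrow> ('a::banach \<Rightarrow>\<^sub>L 'a)) \<Rightarrow> bool" where
  "C0_semigroup \<Delta> T \<longleftrightarrow>
     T 0 = id_blinfun \<and>
     (\<forall>t\<in>\<Delta>. \<forall>s\<in>\<Delta>. T t o\<^sub>L T s = T (t + s)) \<and>
     (\<forall>s\<in>\<Delta>. \<forall>x. ((\<lambda>t. blinfun_apply (T t) x) \<longlongrightarrow> blinfun_apply (T s) x) (at s within \<Delta>))"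

text \<open>
  The filter \<open>inf at_infinity (principal A)\<close> expresses \<open>t \<in> A, |t| \<rightarrow> \<infinity>\<close>.
\<close>

definition dist_semi_irregular ::
    "complex set \<Rightarrow> (complex \<Rightarrow> ('a::banach \<Rightarrow>\<^sub>L 'a)) \<Rightarrow> 'a \<Rightarrow> bool" where
  "dist_semi_irregular \<Delta> T x \<longleftrightarrow>
     (\<exists>A B. A \<in> sets lebesgue \<and> A \<subseteq> \<Delta> \<and> B \<in> sets lebesgue \<and> B \<subseteq> \<Delta> \<and>
        upper_dens \<Delta> A = 1 \<and> upper_dens \<Delta> B = 1 \<and>
        ((\<lambda>t. norm (blinfun_apply (T t) x)) \<longlongrightarrow> 0) (inf at_infinity (principal A)) \<and>
        Liminf (inf at_infinity (principal B)) (\<lambda>t. ereal (norm (blinfun_apply (T t) x))) > 0)"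

definition dist_sensitive ::
    "complex set \<Rightarrow> (complex \<Rightarrow> ('a::banach \<Rightarrow>\<^sub>L 'a)) \<Rightarrow> bool" where
  "dist_sensitive \<Delta> T \<longleftrightarrow>
     (\<exists>\<delta>>0. \<forall>x. \<forall>\<epsilon>>0. \<exists>y. norm (x - y) < \<epsilon> \<and>
        upper_dens \<Delta> {t \<in> \<Delta>. norm (blinfun_apply (T t) x - blinfun_apply (T t) y) > \<delta>} = 1)"

end

theory Submission
  imports Defs "HOL-Real_Asymp.Real_Asymp"
begin

text \<open>
  Let \<open>\<parallel>T\<^sub>t x\<parallel>\<close> tend to \<open>0\<close> along \<open>A\<close> and stay above \<open>\<delta>\<close> far out in \<open>B\<close>. For \<open>s \<in> A\<close> far out the
  vector \<open>w = T\<^sub>s x\<close> is small, while \<open>\<parallel>T\<^sub>t w\<parallel> = \<parallel>T\<^bsub>s+t\<^esub> x\<parallel> > \<delta>\<close> for all large \<open>t\<close> with \<open>s + t \<in> B\<close>.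
  Translation by \<open>s\<close> does not affect upper density, because the part of \<open>\<Delta>\<close> in the disc of radius
  \<open>r\<close> that is missed by \<open>s + \<Delta>\<close> has measure \<open>o(r\<^sup>2)\<close>. So by linearity every \<open>z\<close> is
  separated from \<open>z - w\<close> on a set of upper density \<open>1\<close>.
\<close>

text \<open>Turns a lower bound on a limsup into a statement with \<open>frequently\<close>, the
  form in which density 1 is used. If the bound failed, density of the order would give a value
  strictly between the limsup and \<open>C\<close>.\<close>

lemma le_Limsup_iff:
  fixes X :: "_ \<Rightarrow> 'b :: {complete_linorder, dense_linorder}"
  shows "C \<le> Limsup F X \<longleftrightarrow> (\<forall>y<C. \<exists>\<^sub>F x in F. y < X x)"
proof (intro iffI allI impI)
  fix y assume "C \<le> Limsup F X" "y < C"
  show "\<exists>\<^sub>F x in F. y < X x"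
  proof (rule ccontr)
    assume "\<not> (\<exists>\<^sub>F x in F. y < X x)"
    then have "Limsup F X \<le> y" by (intro Limsup_bounded) (simp add: not_frequently not_less)
    with \<open>C \<le> Limsup F X\<close> \<open>y < C\<close> show False by auto
  qed
next
  assume *: "\<forall>y<C. \<exists>\<^sub>F x in F. y < X x"
  show "C \<le> Limsup F X"
  proof (rule ccontr)
    assume "\<not> C \<le> Limsup F X"
    then obtain y where "Limsup F X < y" "y < C" using dense by (auto simp: not_le)
    from \<open>Limsup F X < y\<close> have "\<forall>\<^sub>F x in F. \<not> y < X x"
      by (auto dest!: Limsup_lessD elim: eventually_mono)
    with * \<open>y < C\<close> show False by (auto simp: frequently_def)
  qed
qed

text \<open>Collects what the argument uses about a sector: the cone property gives scaling,
  closedness gives measurability, convexity gives a negligible frontier, and the nonempty interior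
  gives positive measure.\<close>

locale solid_cone =
  fixes \<Delta> :: "complex set"
  assumes closed: "closed \<Delta>" and convex: "convex \<Delta>" and cone: "cone \<Delta>"
    and solid: "interior \<Delta> \<noteq> {}"
begin

section \<open>Scaling and measure of truncated cones\<close>

lemma scale_iff: "r > 0 \<Longrightarrow> r *\<^sub>R t \<in> \<Delta> \<longleftrightarrow> t \<in> \<Delta>"
  using cone mem_cone[of \<Delta> "r *\<^sub>R t" "inverse r"] mem_cone[of \<Delta> t r] by auto

lemma truncated_eq: "truncated \<Delta> r = \<Delta> \<inter> ball 0 r"
  by (auto simp: truncated_def)

lemma sets_lebesgue: "\<Delta> \<in> sets lebesgue"
  using closed by (simp add: borel_closed)

lemma lmeasurable_truncated: "truncated \<Delta> r \<in> lmeasurable"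
  unfolding truncated_eq
  by (intro bounded_set_imp_lmeasurable) (auto intro: bounded_subset[OF bounded_ball] sets_lebesgue)

lemma lmeasurable_Int_truncated: "A \<in> sets lebesgue \<Longrightarrow> A \<inter> truncated \<Delta> r \<in> lmeasurable"
  by (metis lmeasurable_truncated fmeasurable_Int_fmeasurable Int_commute)

lemma lmeasurable_truncated_diff_translation: "truncated \<Delta> r - (+) s ` \<Delta> \<in> lmeasurable"
  using closed_translation[OF closed, of s]
  by (intro fmeasurable_Diff lmeasurable_truncated) (simp add: borel_closed)

lemma measure_truncated:
  assumes "r > 0"
  shows "measure lebesgue (truncated \<Delta> r) = r\<^sup>2 * measure lebesgue (truncated \<Delta> 1)"
proof -
  \<comment> \<open>The summand 0 gives the dilation the affine shape expected by
    \<open>measure_lebesgue_affine\<close>.\<close>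
  have "truncated \<Delta> r = (\<lambda>x. r *\<^sub>R x + 0) ` truncated \<Delta> 1"
  proof (intro equalityI subsetI)
    fix t assume t: "t \<in> truncated \<Delta> r"
    have "inverse r *\<^sub>R t \<in> truncated \<Delta> 1"
      using t assms scale_iff[of "inverse r" t] by (auto simp: truncated_def field_simps)
    moreover have "t = r *\<^sub>R (inverse r *\<^sub>R t) + 0" using assms by simp
    ultimately show "t \<in> (\<lambda>x. r *\<^sub>R x + 0) ` truncated \<Delta> 1" by blast
  qed (use assms scale_iff in \<open>auto simp: truncated_def\<close>)
  then show ?thesis
    using measure_lebesgue_affine[of r 0 "truncated \<Delta> 1"] assms by simp
qed

text \<open>A nonempty open set is not negligible. The chosen interior point may lie outside the
  unit disc, so positivity is shown at a larger radius first and carried back by scaling.\<close>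

lemma measure_truncated_1_pos: "measure lebesgue (truncated \<Delta> 1) > 0"
proof -
  obtain a where a: "a \<in> interior \<Delta>" using solid by blast
  define U where "U = interior \<Delta> \<inter> ball 0 (cmod a + 1)"
  have "open U" "a \<in> U" using a by (auto simp: U_def)
  then have "\<not> negligible U" using open_not_negligible by blast
  moreover have "U \<subseteq> truncated \<Delta> (cmod a + 1)"
    using interior_subset by (auto simp: U_def truncated_eq)
  ultimately have "\<not> negligible (truncated \<Delta> (cmod a + 1))"
    using negligible_subset by blast
  then have "measure lebesgue (truncated \<Delta> (cmod a + 1)) \<noteq> 0"
    using lmeasurable_truncated negligible_iff_measure by blast
  then have "measure lebesgue (truncated \<Delta> 1) \<noteq> 0"
    by (subst (asm) measure_truncated) (auto simp: add_nonneg_pos)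
  then show ?thesis using measure_nonneg[of lebesgue "truncated \<Delta> 1"] by linarith
qed

lemma measure_truncated_pos: "r > 0 \<Longrightarrow> measure lebesgue (truncated \<Delta> r) > 0"
  by (subst measure_truncated) (simp_all add: measure_truncated_1_pos)

section \<open>Upper density one and growth of truncated cones\<close>

text \<open>The quotients never exceed 1, so only the lower bound on the limsup matters. Clearing
  the eventually positive denominator leaves an inequality between reals.\<close>

lemma upper_dens_eq_1_iff:
  assumes "A \<in> sets lebesgue"
  shows "upper_dens \<Delta> A = 1 \<longleftrightarrow>
    (\<forall>c<1. \<exists>\<^sub>F r in at_top. c * measure lebesgue (truncated \<Delta> r) < measure lebesgue (A \<inter> truncated \<Delta> r))"
proof -
  let ?q = "\<lambda>r. measure lebesgue (A \<inter> truncated \<Delta> r) / measure lebesgue (truncated \<Delta> r)"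
  have q1: "?q r \<le> 1" for r
    using measure_mono_fmeasurable[of "A \<inter> truncated \<Delta> r" "truncated \<Delta> r" lebesgue]
      lmeasurable_truncated lmeasurable_Int_truncated[OF assms, of r] 
    by (auto simp: divide_le_eq_1 fmeasurableD measure_nonneg less_le)
  have "upper_dens \<Delta> A \<le> 1"
    unfolding upper_dens_def by (intro Limsup_bounded) (use q1 in auto)
  then have "upper_dens \<Delta> A = 1 \<longleftrightarrow> 1 \<le> upper_dens \<Delta> A" by auto
  also have "\<dots> \<longleftrightarrow> (\<forall>y<1. \<exists>\<^sub>F r in at_top. y < ereal (?q r))"
    unfolding upper_dens_def by (rule le_Limsup_iff)
  also have "\<dots> \<longleftrightarrow> (\<forall>c<1. \<exists>\<^sub>F r in at_top. c < ?q r)"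
  proof (intro iffI allI impI)
    fix c :: real assume "\<forall>y<1. \<exists>\<^sub>F r in at_top. y < ereal (?q r)" "c < 1"
    then have "\<exists>\<^sub>F r in at_top. ereal c < ereal (?q r)" by (simp del: less_ereal.simps)
    then show "\<exists>\<^sub>F r in at_top. c < ?q r" by simp
  next
    fix y :: ereal assume *: "\<forall>c<1. \<exists>\<^sub>F r in at_top. c < ?q r" and "y < 1"
    \<comment> \<open>A finite \<open>y\<close> is its own bound; 0 serves for
      \<open>y = -\<infinity>\<close>.\<close>
    then obtain c where c: "y \<le> ereal c" "c < 1"
      by (cases y) (auto intro: that[of 0])
    with * have "\<exists>\<^sub>F r in at_top. c < ?q r" by blast
    then show "\<exists>\<^sub>F r in at_top. y < ereal (?q r)"
      by (rule frequently_elim1) (use c(1) in \<open>auto intro: order_le_less_trans\<close>)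
  qed
  also have "\<dots> \<longleftrightarrow> (\<forall>c<1. \<exists>\<^sub>F r in at_top.
      c * measure lebesgue (truncated \<Delta> r) < measure lebesgue (A \<inter> truncated \<Delta> r))"
  proof -
    have "(\<exists>\<^sub>F r in at_top. c < ?q r) = (\<exists>\<^sub>F r in at_top.
      c * measure lebesgue (truncated \<Delta> r) < measure lebesgue (A \<inter> truncated \<Delta> r))" for c
      using eventually_gt_at_top[of 0]
      by (rule frequently_cong) (simp add: measure_truncated_pos pos_less_divide_eq)
    then show ?thesis by (simp only:)
  qed
  finally show ?thesis .
qed

lemma measure_truncated_at_top: "filterlim (\<lambda>r. measure lebesgue (truncated \<Delta> r)) at_top at_top"
proof -
  have "filterlim (\<lambda>r. r\<^sup>2 * measure lebesgue (truncated \<Delta> 1)) at_top at_top"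
    using measure_truncated_1_pos by real_asymp
  moreover have "\<forall>\<^sub>F r in at_top. r\<^sup>2 * measure lebesgue (truncated \<Delta> 1) = measure lebesgue (truncated \<Delta> r)"
    using eventually_gt_at_top[of 0] by eventually_elim (rule measure_truncated[symmetric])
  ultimately show ?thesis using filterlim_cong[OF refl refl] by fastforce
qed

text \<open>Quadratic growth reduces the quotient to that of \<open>(r + a)\<^sup>2\<close> and
  \<open>r\<^sup>2\<close>. Enlarging the radius by a constant is therefore harmless in density
  estimates.\<close>

lemma measure_truncated_shift_ratio:
  "((\<lambda>r. measure lebesgue (truncated \<Delta> (r + a)) / measure lebesgue (truncated \<Delta> r)) \<longlongrightarrow> 1) at_top"
proof -
  have "((\<lambda>r::real. (r + a)\<^sup>2 / r\<^sup>2) \<longlongrightarrow> 1) at_top" by real_asymp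
  moreover have "\<forall>\<^sub>F r in at_top. (r + a)\<^sup>2 / r\<^sup>2 =
      measure lebesgue (truncated \<Delta> (r + a)) / measure lebesgue (truncated \<Delta> r)"
    using eventually_gt_at_top[of 0] eventually_gt_at_top[of "-a"]
  proof eventually_elim
    case (elim r)
    then show ?case
      using measure_truncated_1_pos measure_truncated[of r] measure_truncated[of "r + a"] by simp
  qed
  ultimately show ?thesis by (rule Lim_transform_eventually)
qed

text \<open>If \<open>A\<close> were bounded, its truncations would have bounded measure, yet at
  arbitrarily large radii they fill more than half of a region whose measure tends to
  infinity.\<close>

lemma frequently_at_infinity_if_upper_dens_eq_1:
  assumes "A \<in> sets lebesgue" "upper_dens \<Delta> A = 1"
  shows "\<exists>\<^sub>F t in at_infinity. t \<in> A"
  unfolding frequently_def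
proof
  assume "\<forall>\<^sub>F t in at_infinity. t \<notin> A"
  then obtain b where b: "\<And>t. b \<le> norm t \<Longrightarrow> t \<notin> A" by (auto simp: eventually_at_infinity)
  then have sub: "A \<subseteq> ball 0 b" by force
  have "\<exists>\<^sub>F r in at_top. 1/2 * measure lebesgue (truncated \<Delta> r) < measure lebesgue (A \<inter> truncated \<Delta> r)"
    using assms upper_dens_eq_1_iff[of A] by (auto dest: spec[of _ "1/2"])
  moreover have le: "measure lebesgue (A \<inter> truncated \<Delta> r) \<le> measure lebesgue (ball (0::complex) b)" for r
    using sub lmeasurable_Int_truncated[OF assms(1), of r]
    by (intro measure_mono_fmeasurable) (auto intro: fmeasurableD)
  ultimately have "\<exists>\<^sub>F r in at_top. 1/2 * measure lebesgue (truncated \<Delta> r) < measure lebesgue (ball (0::complex) b)"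
    by - (erule frequently_elim1, erule order_less_le_trans, rule le)
  moreover have "\<forall>\<^sub>F r in at_top. 2 * measure lebesgue (ball (0::complex) b) \<le> measure lebesgue (truncated \<Delta> r)"
    using measure_truncated_at_top unfolding filterlim_at_top by blast
  then have "\<forall>\<^sub>F r in at_top. \<not> 1/2 * measure lebesgue (truncated \<Delta> r) < measure lebesgue (ball (0::complex) b)"
    by (rule eventually_mono) linarith
  ultimately show False unfolding frequently_def by contradiction
qed

section \<open>Translation and upper density\<close>

text \<open>Shrinking by the factor \<open>r\<close> turns the missed region into
  \<open>D r\<close>, where the translation vector \<open>s / r\<close> tends to 0. The indicators
  of \<open>D r\<close> vanish in the limit off the negligible frontier, so dominated convergence
  applies.\<close>

lemma measure_truncated_diff_translation:
  "((\<lambda>r. measure lebesgue (truncated \<Delta> r - (+) s ` \<Delta>) / measure lebesgue (truncated \<Delta> r)) \<longlongrightarrow> 0) at_top"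
proof -
  define D where "D r = truncated \<Delta> 1 - (+) (inverse r *\<^sub>R s) ` \<Delta>" for r
  have D_lm: "D r \<in> lmeasurable" for r
    unfolding D_def by (rule lmeasurable_truncated_diff_translation)
  have scale: "truncated \<Delta> r - (+) s ` \<Delta> = (\<lambda>x. r *\<^sub>R x + 0) ` D r" if "r > 0" for r
  proof -
    have img: "u \<in> (+) h ` \<Delta> \<longleftrightarrow> u - h \<in> \<Delta>" for u h :: complex
      by (auto simp: image_iff algebra_simps intro: bexI[of _ "u - h"])
    have "r *\<^sub>R u \<in> truncated \<Delta> r - (+) s ` \<Delta> \<longleftrightarrow> u \<in> D r" for u
      using that scale_iff[of r u] scale_iff[of r "u - inverse r *\<^sub>R s"]
      unfolding D_def Diff_iff img by (auto simp: truncated_def scaleR_diff_right)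
    moreover have "\<exists>u. t = r *\<^sub>R u" for t :: complex
      using that by (intro exI[of _ "inverse r *\<^sub>R t"]) simp
    ultimately show ?thesis by (auto simp: image_iff) metis+
  qed
  have "((\<lambda>r. integral\<^sup>L lebesgue (indicator (D r) :: complex \<Rightarrow> real)) \<longlongrightarrow>
      integral\<^sup>L lebesgue (\<lambda>_::complex. 0::real)) at_top"
  proof (rule integral_dominated_convergence_at_top)
    show "integrable lebesgue (indicator (truncated \<Delta> 1) :: complex \<Rightarrow> real)"
      using lmeasurable_truncated[of 1] by (auto simp: fmeasurable_def)
    show "\<forall>\<^sub>F r in at_top. AE t in lebesgue. norm (indicator (D r) t :: real) \<le> indicator (truncated \<Delta> 1) t"
      by (auto simp: D_def indicator_def)
    have "AE t in lebesgue. t \<notin> frontier \<Delta>"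
      using negligible_convex_frontier[OF convex] by (simp add: AE_not_in negligible_iff_null_sets)
    then show "AE t in lebesgue. ((\<lambda>r. indicator (D r) t :: real) \<longlongrightarrow> 0) at_top"
    proof eventually_elim
      case (elim t)
      have "\<forall>\<^sub>F r in at_top. t \<notin> D r"
      proof (cases "t \<in> \<Delta>")
        case True
        \<comment> \<open>The points \<open>t - s / r\<close> tend to \<open>t\<close>, so they
          eventually lie in the interior, which puts \<open>t\<close> into the translated cone and
          outside \<open>D r\<close>.\<close>
        then have "t \<in> interior \<Delta>" using elim closure_subset by (auto simp: frontier_def)
        moreover have "((\<lambda>r. t - inverse r *\<^sub>R s) \<longlongrightarrow> t - 0 *\<^sub>R s) at_top"
          by (intro tendsto_intros tendsto_inverse_0_at_top filterlim_ident)
        ultimately have "\<forall>\<^sub>F r in at_top. t - inverse r *\<^sub>R s \<in> interior \<Delta>"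
          by (intro topological_tendstoD) auto
        then show ?thesis
        proof eventually_elim
          case (elim r)
          then show ?case using interior_subset unfolding D_def
            by (auto simp: image_iff intro!: bexI[of _ "t - inverse r *\<^sub>R s"])
        qed
      qed (auto simp: D_def truncated_def)
      then show ?case by (auto intro!: tendsto_eventually elim: eventually_mono)
    qed
  qed (use D_lm in auto)
  then have "((\<lambda>r. measure lebesgue (D r)) \<longlongrightarrow> 0) at_top"
    using D_lm by simp
  then have "((\<lambda>r. measure lebesgue (D r) / measure lebesgue (truncated \<Delta> 1)) \<longlongrightarrow> 0) at_top"
    using tendsto_divide_zero by blast
  \<comment> \<open>Numerator and denominator scale by the same factor \<open>r\<^sup>2\<close>,
    which cancels.\<close>
  moreover have "\<forall>\<^sub>F r in at_top. measure lebesgue (D r) / measure lebesgue (truncated \<Delta> 1) =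
      measure lebesgue (truncated \<Delta> r - (+) s ` \<Delta>) / measure lebesgue (truncated \<Delta> r)"
    using eventually_gt_at_top[of 0]
  proof eventually_elim
    case (elim r)
    then have "measure lebesgue (truncated \<Delta> r - (+) s ` \<Delta>) = r\<^sup>2 * measure lebesgue (D r)"
      using measure_lebesgue_affine[of r 0 "D r"] by (simp add: scale)
    then show ?case using elim by (simp add: measure_truncated[of r])
  qed
  ultimately show ?thesis by (rule Lim_transform_eventually)
qed

text \<open>Up to the region missed by the translated cone and a fixed ball, \<open>B\<close> is
  covered by the translate of \<open>E\<close>. Both errors are negligible relative to the truncated
  cone, as is the change of radius.\<close>

lemma upper_dens_eq_1_translation:
  assumes B: "B \<in> sets lebesgue" "upper_dens \<Delta> B = 1" and E: "E \<in> sets lebesgue"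
    and BE: "\<And>t. t \<in> \<Delta> \<Longrightarrow> s + t \<in> B \<Longrightarrow> R \<le> cmod (s + t) \<Longrightarrow> t \<in> E"
  shows "upper_dens \<Delta> E = 1"
  unfolding upper_dens_eq_1_iff[OF E]
proof (intro allI impI)
  fix c :: real assume "c < 1"
  let ?\<mu> = "measure lebesgue" and ?a = "cmod s"
  let ?m = "\<lambda>r. ?\<mu> (truncated \<Delta> r)" and ?d = "\<lambda>r. ?\<mu> (truncated \<Delta> r - (+) s ` \<Delta>)"
    and ?b = "?\<mu> (ball (0::complex) R)"
  \<comment> \<open>The radius grows by \<open>cmod s\<close> because a point \<open>u\<close> of
    \<open>B\<close> corresponds to \<open>u - s\<close> in \<open>E\<close>.\<close>
  have sub: "?\<mu> (B \<inter> truncated \<Delta> r) \<le> ?\<mu> (E \<inter> truncated \<Delta> (r + ?a)) + ?d r + ?b" for r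
  proof -
    let ?E = "(+) s ` (E \<inter> truncated \<Delta> (r + ?a))" and ?D = "truncated \<Delta> r - (+) s ` \<Delta>"
    have D: "?D \<in> lmeasurable" by (rule lmeasurable_truncated_diff_translation)
    have E': "?E \<in> lmeasurable"
      using lmeasurable_Int_truncated[OF E] measurable_translation by blast
    have "B \<inter> truncated \<Delta> r \<subseteq> ?E \<union> ?D \<union> ball 0 R"
    proof
      fix u assume u: "u \<in> B \<inter> truncated \<Delta> r"
      show "u \<in> ?E \<union> ?D \<union> ball 0 R"
      proof (cases "u \<in> (+) s ` \<Delta> \<and> R \<le> cmod u")
        case True
        then obtain t where t: "t \<in> \<Delta>" "u = s + t" by blast
        have "cmod t \<le> cmod u + ?a" using norm_triangle_ineq4[of u s] t by simp
        then have "t \<in> truncated \<Delta> (r + ?a)" using t u by (auto simp: truncated_def)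
        moreover have "t \<in> E" using BE t u True by auto
        ultimately show ?thesis using t by blast
      qed (use u in auto)
    qed
    then have "?\<mu> (B \<inter> truncated \<Delta> r) \<le> ?\<mu> (?E \<union> ?D \<union> ball 0 R)"
      using D E' lmeasurable_Int_truncated[OF B(1), of r]
      by (intro measure_mono_fmeasurable fmeasurable.Un) (auto intro: fmeasurableD)
    also have "\<dots> \<le> ?\<mu> ?E + ?\<mu> ?D + ?b"
      using D E' measure_Un_le[of "?E \<union> ?D" lebesgue "ball 0 R"] measure_Un_le[of ?E lebesgue ?D]
      by (simp add: fmeasurableD)
    finally show ?thesis by (simp add: measure_translation)
  qed
  have "((\<lambda>r. c * (?m (r + ?a) / ?m r) + ?d r / ?m r + ?b / ?m r) \<longlongrightarrow> c * 1 + 0 + 0) at_top"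
    by (intro tendsto_intros measure_truncated_shift_ratio measure_truncated_diff_translation
        tendsto_divide_0[OF tendsto_const] filterlim_at_top_imp_at_infinity measure_truncated_at_top)
  \<comment> \<open>The midpoint of \<open>c\<close> and 1 leaves room on both sides: above
    \<open>c\<close> for the errors, below 1 for the density of \<open>B\<close>.\<close>
  then have "\<forall>\<^sub>F r in at_top. c * (?m (r + ?a) / ?m r) + ?d r / ?m r + ?b / ?m r < (1 + c) / 2"
    by (rule order_tendstoD) (use \<open>c < 1\<close> in simp)
  then have ev: "\<forall>\<^sub>F r in at_top. c * ?m (r + ?a) + ?d r + ?b < (1 + c) / 2 * ?m r"
    using eventually_gt_at_top[of 0]
  proof eventually_elim
    case (elim r)
    have "(c * ?m (r + ?a) + ?d r + ?b) / ?m r < (1 + c) / 2"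
      using elim(1) by (simp add: add_divide_distrib)
    then show ?case using measure_truncated_pos[OF elim(2)] by (simp only: pos_divide_less_eq)
  qed
  have "\<exists>\<^sub>F r in at_top. (1 + c) / 2 * ?m r < ?\<mu> (B \<inter> truncated \<Delta> r)"
    using B \<open>c < 1\<close> upper_dens_eq_1_iff[OF B(1)] by (auto dest: spec[of _ "(1 + c) / 2"])
  then have *: "\<exists>\<^sub>F r in at_top. c * ?m (r + ?a) < ?\<mu> (E \<inter> truncated \<Delta> (r + ?a))"
    by (rule frequently_rev_mp) (use ev in eventually_elim, use sub in \<open>smt (verit)\<close>)
  \<comment> \<open>Radii of the form \<open>r + cmod s\<close> that are arbitrarily large yield
    arbitrarily large radii for \<open>E\<close>.\<close>
  have "filterlim (\<lambda>r. r + ?a) at_top at_top" by real_asymp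
  with * show "\<exists>\<^sub>F r in at_top. c * ?m r < ?\<mu> (E \<inter> truncated \<Delta> r)"
    unfolding frequently_def by (auto dest: eventually_compose_filterlim)
qed

section \<open>Sensitivity from a semi-irregular vector\<close>

lemma dist_sensitive_if_dist_semi_irregular:
  assumes T: "C0_semigroup \<Delta> T" and x: "dist_semi_irregular \<Delta> T x"
  shows "dist_sensitive \<Delta> T"
proof -
  obtain A B where A: "A \<in> sets lebesgue" "A \<subseteq> \<Delta>" "upper_dens \<Delta> A = 1"
    and B: "B \<in> sets lebesgue" "B \<subseteq> \<Delta>" "upper_dens \<Delta> B = 1"
    and limA: "((\<lambda>t. norm (T t x)) \<longlongrightarrow> 0) (inf at_infinity (principal A))"
    and limB: "Liminf (inf at_infinity (principal B)) (\<lambda>t. ereal (norm (T t x))) > 0"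
    using x unfolding dist_semi_irregular_def by blast
  \<comment> \<open>A finite \<open>\<delta>\<close> exists even when the liminf is infinite. It is
    fixed before \<open>z\<close> and \<open>\<epsilon>\<close>, so the sensitivity constant is
    uniform.\<close>
  obtain \<delta> where \<delta>: "0 < \<delta>" "ereal \<delta> < Liminf (inf at_infinity (principal B)) (\<lambda>t. ereal (norm (T t x)))"
    using ereal_dense2[OF limB] by auto
  have "\<forall>\<^sub>F t in inf at_infinity (principal B). \<delta> < norm (T t x)"
    using less_LiminfD[OF \<delta>(2)] by simp
  then obtain R where R: "\<And>t. R \<le> norm t \<Longrightarrow> t \<in> B \<Longrightarrow> \<delta> < norm (T t x)"
    by (auto simp: eventually_inf_principal eventually_at_infinity)
  show ?thesis unfolding dist_sensitive_def
  proof (intro exI[of _ \<delta>] conjI allI impI)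
    fix z :: 'a and \<epsilon> :: real assume "\<epsilon> > 0"
    have "\<forall>\<^sub>F t in inf at_infinity (principal A). norm (T t x) < \<epsilon>"
      using order_tendstoD(2)[OF limA \<open>\<epsilon> > 0\<close>] .
    then have "\<forall>\<^sub>F t in at_infinity. t \<in> A \<longrightarrow> t \<in> A \<and> norm (T t x) < \<epsilon>"
      by (simp add: eventually_inf_principal)
    with frequently_at_infinity_if_upper_dens_eq_1[OF A(1,3)]
    have "\<exists>\<^sub>F t in at_infinity. t \<in> A \<and> norm (T t x) < \<epsilon>"
      by (rule frequently_rev_mp)
    then obtain s where s: "s \<in> A" "norm (T s x) < \<epsilon>" by (auto dest: frequently_ex)
    define w where "w = T s x"
    have Tw: "T t w = T (s + t) x" if "t \<in> \<Delta>" for t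
      using T that s A(2) unfolding C0_semigroup_def w_def
      by (metis add.commute blinfun_apply_blinfun_compose subsetD)
    let ?E = "{t \<in> \<Delta>. \<delta> < norm (T t w)}"
    \<comment> \<open>Strong continuity makes \<open>?E\<close> relatively open in the closed set
      \<open>\<Delta>\<close>, hence measurable, as the density criterion demands.\<close>
    have "continuous_on \<Delta> (\<lambda>t. norm (T t w))"
      using T unfolding C0_semigroup_def continuous_on_def by (auto intro: tendsto_norm)
    then have "openin (top_of_set \<Delta>) (\<Delta> \<inter> (\<lambda>t. norm (T t w)) -` {\<delta><..})"
      by (intro continuous_openin_preimage_gen) auto
    then obtain U where "open U" "\<Delta> \<inter> (\<lambda>t. norm (T t w)) -` {\<delta><..} = \<Delta> \<inter> U"
      by (auto simp: openin_open)
    moreover have "?E = \<Delta> \<inter> (\<lambda>t. norm (T t w)) -` {\<delta><..}" by auto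
    ultimately have "?E \<in> sets lebesgue"
      using sets_lebesgue by (simp add: sets.Int borel_open)
    then have "upper_dens \<Delta> ?E = 1"
      by (rule upper_dens_eq_1_translation[OF B(1,3), where s = s and R = R]) (use R Tw in auto)
    moreover have "T t z - T t (z - w) = T t w" for t
      by (simp add: blinfun.diff_right)
    ultimately show "\<exists>y. norm (z - y) < \<epsilon> \<and> upper_dens \<Delta> {t \<in> \<Delta>. \<delta> < norm (T t z - T t y)} = 1"
      using s by (intro exI[of _ "z - w"]) (auto simp: w_def)
  qed (use \<delta> in auto)
qed

end

section \<open>Sectors as solid cones\<close>

text \<open>Since cosine decreases on \<open>[0, pi]\<close>, the bound on the angle becomes a bound
  on its cosine. The resulting inequality makes the cone properties accessible without polar
  coordinates.\<close>

lemma sector_eq: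
  assumes "0 \<le> \<alpha>" "\<alpha> \<le> pi"
  shows "sector \<alpha> = {z. cos \<alpha> * cmod z \<le> Re z}"
proof (intro equalityI subsetI)
  fix z assume "z \<in> sector \<alpha>"
  then obtain r \<theta> where z: "z = rcis r \<theta>" "0 \<le> r" "\<bar>\<theta>\<bar> \<le> \<alpha>" by (auto simp: sector_def)
  have "cos \<alpha> \<le> cos \<bar>\<theta>\<bar>" using z assms by (intro cos_monotone_0_pi_le) auto
  then have "cos \<alpha> * r \<le> cos \<theta> * r" using z by (intro mult_right_mono) auto
  then show "z \<in> {z. cos \<alpha> * cmod z \<le> Re z}" using z by (simp add: mult.commute)
next
  fix z assume z: "z \<in> {z. cos \<alpha> * cmod z \<le> Re z}"
  show "z \<in> sector \<alpha>"
  proof (cases "z = 0")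
    case True
    then show ?thesis using assms by (auto simp: sector_def intro!: exI[of _ 0])
  next
    case False
    have zr: "z = rcis (cmod z) (Arg z)" by (simp add: rcis_cmod_Arg)
    have "Re z = cmod z * cos (Arg z)" by (metis zr Re_rcis)
    with z have "cmod z * cos \<alpha> \<le> cmod z * cos \<bar>Arg z\<bar>" by (simp add: mult.commute)
    then have "cos \<alpha> \<le> cos \<bar>Arg z\<bar>" using False by simp
    then have "\<bar>Arg z\<bar> \<le> \<alpha>"
      using assms Arg_bounded[of z] by (subst (asm) cos_mono_le_eq) auto
    then show ?thesis unfolding sector_def using zr by force
  qed
qed

text \<open>As \<open>cos \<alpha>\<close> is nonnegative, the triangle inequality shows that the
  defining inequality is preserved by sums, which with scaling gives convexity. The strict
  inequality defines an open subset containing 1.\<close>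

lemma solid_cone_sector:
  assumes "0 < \<alpha>" "\<alpha> \<le> pi / 2"
  shows "solid_cone (sector \<alpha>)"
proof
  have eq: "sector \<alpha> = {z. cos \<alpha> * cmod z \<le> Re z}" using assms by (intro sector_eq) auto
  have c0: "0 \<le> cos \<alpha>" using assms by (intro cos_ge_zero) auto
  show "closed (sector \<alpha>)" unfolding eq by (intro closed_Collect_le continuous_intros)
  show cone: "cone (sector \<alpha>)"
    unfolding cone_def eq by (auto simp: mult.left_commute mult_left_mono)
  have "u + v \<in> sector \<alpha>" if "u \<in> sector \<alpha>" "v \<in> sector \<alpha>" for u v
    using mult_left_mono[OF norm_triangle_ineq[of u v] c0] that by (simp add: eq distrib_left)
  with cone show "convex (sector \<alpha>)" by (auto intro: convex_cone[THEN iffD2, THEN conjunct1] simp: convex_cone cone_def)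
  have "open {z. cos \<alpha> * cmod z < Re z}" by (intro open_Collect_less continuous_intros)
  moreover have "{z. cos \<alpha> * cmod z < Re z} \<subseteq> sector \<alpha>" by (auto simp: eq)
  moreover have "1 \<in> {z. cos \<alpha> * cmod z < Re z}"
    using assms cos_monotone_0_pi[of 0 \<alpha>] by simp
  ultimately show "interior (sector \<alpha>) \<noteq> {}" using interior_maximal by blast
qed

theorem theorem3p9:
  fixes T :: "complex \<Rightarrow> ('a::banach \<Rightarrow>\<^sub>L 'a)" and \<alpha> :: real
  assumes "0 < \<alpha>" and "\<alpha> < pi / 2"
    and "C0_semigroup (sector \<alpha>) T"
    and "\<exists>x. dist_semi_irregular (sector \<alpha>) T x"
  shows "dist_sensitive (sector \<alpha>) T"
  using assms solid_cone.dist_sensitive_if_dist_semi_irregular[OF solid_cone_sector[of \<alpha>]] by auto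

end
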